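(* Let $\Phi_1,\Phi_2$ be point processes on $\mathbb{R}^d$ and let $\nu_j(B)=\mathsf{P}(\Phi_j(B)=0)$, $j=1,2$, denote their void probabilities. If $\Phi_1\le_{ddcx}\Phi_2$, then $\nu_1(B)\le \nu_2(B)$ for all bounded Borel sets $B\subset\mathbb{R}^d$.
   Context: A point process on $\mathbb{R}^d$ is a random locally finite counting measure; all point processes are assumed to have Radon (finite on bounded sets) mean measure. A Lebesgue-measurable $f:\mathbb{R}^k\to\mathbb{R}$ is directionally convex ($dcx$) if for all $x,y,p,q\in\mathbb{R}^k$ with $p\le x\le q$, $p\le y\le q$ (coordinatewise) and $x+y=p+q$ one has $f(x)+f(y)\le f(p)+f(q)$; $f$ is $ddcx$ if it is $dcx$ and coordinatewise decreasing. For a class $\mathfrak F$ of such functions, random vectors satisfy $X\le_{\mathfrak F}Y$ if $\mathsf{E}f(X)\le \mathsf{E}f(Y)$ for all $f\in\mathfrak F$ for which both expectations are finite. Point processes satisfy $\Phi_1\le_{\mathfrak F}\Phi_2$ if $(\Phi_1(B_1),\dots,\Phi_1(B_k))\le_{\mathfrak F}(\Phi_2(B_1),\dots,\Phi_2(B_k))$ for every $k\ge1$ and all bounded Borel sets $B_1,\dots,B_k\subset\mathbb{R}^d$. *)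

theory Defs
  imports "HOL-Probability.Probability"
begin

text \<open>Vectors in $R^k$ are extensional functions on \<open>{..<k}\<close>, i.e. elements of
  \<open>{..<k} \<rightarrow>\<^sub>E UNIV\<close>, because the order on point processes quantifies over \<open>k\<close>.\<close>

definition lebesgue_vec :: "nat \<Rightarrow> (nat \<Rightarrow> real) measure" where
  "lebesgue_vec k = completion (Pi\<^sub>M {..<k} (\<lambda>_. lborel))"

definition vec_le :: "nat \<Rightarrow> (nat \<Rightarrow> real) \<Rightarrow> (nat \<Rightarrow> real) \<Rightarrow> bool" where
  "vec_le k x y \<longleftrightarrow> (\<forall>i<k. x i \<le> y i)"

definition dcx :: "nat \<Rightarrow> ((nat \<Rightarrow> real) \<Rightarrow> real) set" where
  "dcx k = {f \<in> borel_measurable (lebesgue_vec k).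
     \<forall>x \<in> {..<k} \<rightarrow>\<^sub>E UNIV. \<forall>y \<in> {..<k} \<rightarrow>\<^sub>E UNIV. \<forall>p \<in> {..<k} \<rightarrow>\<^sub>E UNIV. \<forall>q \<in> {..<k} \<rightarrow>\<^sub>E UNIV.
       vec_le k p x \<and> vec_le k x q \<and> vec_le k p y \<and> vec_le k y q \<and>
       (\<forall>i<k. x i + y i = p i + q i) \<longrightarrow> f x + f y \<le> f p + f q}"

text \<open>``Decreasing'' is understood in the weak sense.\<close>

definition ddcx :: "nat \<Rightarrow> ((nat \<Rightarrow> real) \<Rightarrow> real) set" where
  "ddcx k = {f \<in> dcx k.
     \<forall>x \<in> {..<k} \<rightarrow>\<^sub>E UNIV. \<forall>y \<in> {..<k} \<rightarrow>\<^sub>E UNIV. vec_le k x y \<longrightarrow> f y \<le> f x}"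

text \<open>The two random vectors may live on different probability spaces. Finiteness of an
  expectation is Bochner integrability; without it the integral would be \<open>0\<close> by convention.\<close>

definition rvec_le :: "((nat \<Rightarrow> real) \<Rightarrow> real) set \<Rightarrow>
    'w measure \<Rightarrow> ('w \<Rightarrow> nat \<Rightarrow> real) \<Rightarrow> 'v measure \<Rightarrow> ('v \<Rightarrow> nat \<Rightarrow> real) \<Rightarrow> bool" where
  "rvec_le F M X N Y \<longleftrightarrow> (\<forall>f\<in>F. integrable M (\<lambda>w. f (X w)) \<longrightarrow> integrable N (\<lambda>v. f (Y v)) \<longrightarrow>
     (\<integral>w. f (X w) \<partial>M) \<le> (\<integral>v. f (Y v) \<partial>N))"

text \<open>Counting measure in the sense of point process theory, with multiple points allowed:
  integer valued, and finite, on bounded Borel sets.\<close>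

definition loc_fin_counting_measure :: "'a::euclidean_space measure \<Rightarrow> bool" where
  "loc_fin_counting_measure \<mu> \<longleftrightarrow> sets \<mu> = sets borel \<and>
     (\<forall>B\<in>sets borel. bounded B \<longrightarrow> (\<exists>n::nat. emeasure \<mu> B = of_nat n))"

text \<open>The last condition states that the mean measure is Radon.\<close>

definition point_process :: "'w measure \<Rightarrow> ('w \<Rightarrow> 'a::euclidean_space measure) \<Rightarrow> bool" where
  "point_process M \<Phi> \<longleftrightarrow> prob_space M \<and>
     (\<forall>w\<in>space M. loc_fin_counting_measure (\<Phi> w)) \<and>
     (\<forall>B\<in>sets borel. bounded B \<longrightarrow> (\<lambda>w. emeasure (\<Phi> w) B) \<in> borel_measurable M) \<and>
     (\<forall>B\<in>sets borel. bounded B \<longrightarrow> (\<integral>\<^sup>+ w. emeasure (\<Phi> w) B \<partial>M) < \<infinity>)"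

definition pp_le :: "(nat \<Rightarrow> ((nat \<Rightarrow> real) \<Rightarrow> real) set) \<Rightarrow>
    'w measure \<Rightarrow> ('w \<Rightarrow> 'a::euclidean_space measure) \<Rightarrow>
    'v measure \<Rightarrow> ('v \<Rightarrow> 'a measure) \<Rightarrow> bool" where
  "pp_le F M \<Phi> N \<Psi> \<longleftrightarrow> (\<forall>k\<ge>1. \<forall>B :: nat \<Rightarrow> 'a set.
     (\<forall>i<k. B i \<in> sets borel \<and> bounded (B i)) \<longrightarrow>
     rvec_le (F k) M (\<lambda>w. \<lambda>i\<in>{..<k}. measure (\<Phi> w) (B i))
                   N (\<lambda>v. \<lambda>i\<in>{..<k}. measure (\<Psi> v) (B i)))"

definition void_prob :: "'w measure \<Rightarrow> ('w \<Rightarrow> 'a::euclidean_space measure) \<Rightarrow> 'a set \<Rightarrow> real" where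
  "void_prob M \<Phi> B = measure M {w \<in> space M. emeasure (\<Phi> w) B = 0}"

end

(* The function max 0 (1 - x) is convex and decreasing, hence in ddcx 1, and agrees on the
   nonnegative integers with the indicator of 0; so the void probability of B is the expectation
   of this function of the number of points in B. *)

theory Submission
  imports Defs
begin

text \<open>For \<open>k = 1\<close> both conditions concern the coordinate \<open>x 0\<close>
  alone, and splitting each maximum reduces them to linear arithmetic.\<close>

lemma hinge_in_ddcx: "(\<lambda>x. max 0 (1 - x 0)) \<in> ddcx 1"
proof -
  have "(\<lambda>x::nat \<Rightarrow> real. max 0 (1 - x 0)) \<in> borel_measurable (Pi\<^sub>M {..<1} (\<lambda>_. lborel))"
    by measurable
  then have "(\<lambda>x::nat \<Rightarrow> real. max 0 (1 - x 0)) \<in> borel_measurable (lebesgue_vec 1)"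
    unfolding lebesgue_vec_def by (rule measurable_completion)
  then show ?thesis
    unfolding ddcx_def dcx_def vec_le_def by (auto simp: max_def)
qed

lemma hinge_measure_eq_indicator:
  assumes "loc_fin_counting_measure \<mu>" "B \<in> sets borel" "bounded B"
  shows "max 0 (1 - measure \<mu> B) = indicator {0} (emeasure \<mu> B)"
proof -
  from assms obtain n :: nat where "emeasure \<mu> B = of_nat n"
    unfolding loc_fin_counting_measure_def by blast
  \<comment> \<open>Finiteness matters: \<open>measure\<close> sends infinite mass to 0, where the
    hinge would be 1 but the indicator 0.\<close>
  moreover from this have "measure \<mu> B = real n"
    by (simp add: measure_def flip: ennreal_of_nat_eq_real_of_nat)
  ultimately show ?thesis
    by (cases n) auto
qed

text \<open>Integrability is proved alongside the value because \<open>rvec_le\<close> compares only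
  test functions whose two expectations are finite.\<close>

lemma
  assumes "point_process M \<Phi>" "B \<in> sets borel" "bounded B"
  shows integrable_hinge_count: "integrable M (\<lambda>w. max 0 (1 - measure (\<Phi> w) B))" (is ?int)
    and integral_hinge_count: "(\<integral>w. max 0 (1 - measure (\<Phi> w) B) \<partial>M) = void_prob M \<Phi> B" (is ?eq)
proof -
  interpret prob_space M
    using assms(1) by (simp add: point_process_def)
  have [measurable]: "(\<lambda>w. emeasure (\<Phi> w) B) \<in> borel_measurable M"
    using assms by (simp add: point_process_def)
  let ?A = "{w \<in> space M. emeasure (\<Phi> w) B = 0}"
  have A: "?A \<in> sets M"
    by measurable
  have eq: "max 0 (1 - measure (\<Phi> w) B) = indicator ?A w" if "w \<in> space M" for w
    using hinge_measure_eq_indicator[of "\<Phi> w" B] assms that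
    by (auto simp: point_process_def indicator_def)
  \<comment> \<open>An event of a probability space has finite measure, so its indicator is
    integrable.\<close>
  have "integrable M (indicator ?A :: _ \<Rightarrow> real)"
    using A by (simp add: emeasure_eq_measure)
  then show ?int
    using eq by (simp cong: Bochner_Integration.integrable_cong)
  show ?eq
    using eq A by (simp add: void_prob_def cong: Bochner_Integration.integral_cong)
qed

theorem proposition3p3:
  fixes M\<^sub>1 :: "'w measure" and M\<^sub>2 :: "'v measure"
    and \<Phi>\<^sub>1 :: "'w \<Rightarrow> (real ^ 'd) measure" and \<Phi>\<^sub>2 :: "'v \<Rightarrow> (real ^ 'd) measure"
  assumes "point_process M\<^sub>1 \<Phi>\<^sub>1" and "point_process M\<^sub>2 \<Phi>\<^sub>2"
    and "pp_le ddcx M\<^sub>1 \<Phi>\<^sub>1 M\<^sub>2 \<Phi>\<^sub>2"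
  shows "\<forall>B \<in> sets borel. bounded B \<longrightarrow> void_prob M\<^sub>1 \<Phi>\<^sub>1 B \<le> void_prob M\<^sub>2 \<Phi>\<^sub>2 B"
proof (intro ballI impI)
  fix B :: "(real ^ 'd) set"
  assume B: "B \<in> sets borel" "bounded B"
  \<comment> \<open>One set suffices: the order is used only for \<open>k = 1\<close> and the
    constant family \<open>B\<close>, and the hinge reads coordinate 0 of the resulting
    vector.\<close>
  have "rvec_le (ddcx 1) M\<^sub>1 (\<lambda>w. \<lambda>i\<in>{..<1}. measure (\<Phi>\<^sub>1 w) B)
                         M\<^sub>2 (\<lambda>v. \<lambda>i\<in>{..<1}. measure (\<Phi>\<^sub>2 v) B)"
    using assms(3)[unfolded pp_le_def, rule_format, of 1 "\<lambda>_. B"] B by simp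
  from this[unfolded rvec_le_def, rule_format, OF hinge_in_ddcx]
  show "void_prob M\<^sub>1 \<Phi>\<^sub>1 B \<le> void_prob M\<^sub>2 \<Phi>\<^sub>2 B"
    using integrable_hinge_count[OF assms(1) B] integrable_hinge_count[OF assms(2) B]
      integral_hinge_count[OF assms(1) B] integral_hinge_count[OF assms(2) B]
    by simp
qed

end
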